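(* Finite VC dimension is neither necessary nor sufficient for PAC learnability with improvements. That is: (i) (not necessary) there exist an instance space $\mathcal{X}$, a concept class $\mathcal{H}\subseteq\{0,1\}^{\mathcal{X}}$ of infinite VC dimension and an improvement function $\Delta:\mathcal{X}\to 2^{\mathcal{X}}$ such that $\mathcal{H}$ is PAC learnable with improvements with respect to $\Delta$; (ii) (not sufficient) there exist an instance space $\mathcal{X}$, a concept class $\mathcal{H}\subseteq\{0,1\}^{\mathcal{X}}$ of finite VC dimension and an improvement function $\Delta:\mathcal{X}\to 2^{\mathcal{X}}$ such that $\mathcal{H}$ is not PAC learnable with improvements with respect to $\Delta$.
   Context: Setting. $\mathcal{X}$ is an instance space and labels are in $\{0,1\}$ ($0$ negative, $1$ positive). An improvement function is a map $\Delta:\mathcal{X}\to 2^{\mathcal{X}}$; $\Delta(x)$ is the set of points to which $x$ can move. For a classifier $h:\mathcal{X}\to\{0,1\}$ the reaction set of $x$ is: $\Delta_h(x)=\{x\}$ if $h(x)=1$; $\Delta_h(x)=\{x\}$ if $\{x'\in\Delta(x): h(x')=1\}=\emptyset$; and $\Delta_h(x)=\{x'\in\Delta(x):h(x')=1\}$ otherwise. For a target $f^*:\mathcal{X}\to\{0,1\}$, $\mathrm{Loss}(x;h,f^* )=\max_{x'\in\Delta_h(x)}\mathbb{I}[h(x')\neq f^*(x')]$, and for a distribution $\mathcal{D}$ on $\mathcal{X}$, $\mathrm{Loss}_{\mathcal{D}}(h,f^* )=\mathbb{P}_{x\sim\mathcal{D}}[\mathrm{Loss}(x;h,f^* )=1]$.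 PAC learning with improvements (realizable). An algorithm PAC-learns $\mathcal{H}$ with improvements with respect to $\Delta$ and $\mathcal{D}$ using sample size $M$ (which may depend on $\epsilon,\delta$) if for any $f^*\in\mathcal{H}$ and $\epsilon,\delta>0$, given $M$ i.i.d. examples from $\mathcal{D}$ labeled by $f^*$, it outputs with probability at least $1-\delta$ a hypothesis $h:\mathcal{X}\to\{0,1\}$ (not required to be in $\mathcal{H}$) with $\mathrm{Loss}_{\mathcal{D}}(h,f^* )\le\epsilon$. $\mathcal{H}$ is PAC learnable with improvements with respect to $\Delta$ if there are a finite sample size function $M(\epsilon,\delta)$ and an algorithm achieving this for all distributions $\mathcal{D}$ on $\mathcal{X}$. *)

theory Defs
  imports "HOL-Probability.Probability" "HOL-Library.Extended_Nat"
begin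

text \<open>Labels are booleans: \<open>True\<close> is the positive label 1, \<open>False\<close> the negative label 0.\<close>

definition shatters :: "('a \<Rightarrow> bool) set \<Rightarrow> 'a set \<Rightarrow> bool" where
  "shatters H S \<longleftrightarrow> (\<lambda>f. {x \<in> S. f x}) ` H = Pow S"

definition vc_dim :: "'a set \<Rightarrow> ('a \<Rightarrow> bool) set \<Rightarrow> enat" where
  "vc_dim X H = (SUP S \<in> {S. S \<subseteq> X \<and> finite S \<and> shatters H S}. enat (card S))"

definition reaction_set :: "('a \<Rightarrow> 'a set) \<Rightarrow> ('a \<Rightarrow> bool) \<Rightarrow> 'a \<Rightarrow> 'a set" where
  "reaction_set \<Delta> h x =
     (if h x then {x}
      else if {x' \<in> \<Delta> x. h x'} = {} then {x}
      else {x' \<in> \<Delta> x. h x'})"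

text \<open>The maximum is over a nonempty subset of \<open>{0, 1}\<close>, even when the reaction set is infinite.\<close>

definition improvement_loss ::
    "('a \<Rightarrow> 'a set) \<Rightarrow> ('a \<Rightarrow> bool) \<Rightarrow> ('a \<Rightarrow> bool) \<Rightarrow> 'a \<Rightarrow> nat" where
  "improvement_loss \<Delta> h f x = Max ((\<lambda>x'. of_bool (h x' \<noteq> f x')) ` reaction_set \<Delta> h x)"

definition error_event ::
    "'a measure \<Rightarrow> ('a \<Rightarrow> 'a set) \<Rightarrow> ('a \<Rightarrow> bool) \<Rightarrow> ('a \<Rightarrow> bool) \<Rightarrow> 'a set" where
  "error_event D \<Delta> h f = {x \<in> space D. improvement_loss \<Delta> h f x = 1}"

definition population_loss ::
    "'a measure \<Rightarrow> ('a \<Rightarrow> 'a set) \<Rightarrow> ('a \<Rightarrow> bool) \<Rightarrow> ('a \<Rightarrow> bool) \<Rightarrow> real" where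
  "population_loss D \<Delta> h f = measure D (error_event D \<Delta> h f)"

definition labeled_sample :: "('a \<Rightarrow> bool) \<Rightarrow> nat \<Rightarrow> (nat \<Rightarrow> 'a) \<Rightarrow> ('a \<times> bool) list" where
  "labeled_sample f m s = map (\<lambda>i. (s i, f (s i))) [0..<m]"

text \<open>
  An algorithm is an arbitrary map \<open>A\<close> from finite labeled samples to hypotheses, so it is
  possibly improper.  The samples are i.i.d. because \<open>s\<close> is drawn from the product measure.
  Since \<open>measure\<close> is 0 on non-measurable sets, the error event is required to be measurable;
  this holds automatically if the instance space carries the discrete sigma-algebra.
\<close>

definition pac_learns_with_improvements ::
    "(('a \<times> bool) list \<Rightarrow> 'a \<Rightarrow> bool) \<Rightarrow> ('a \<Rightarrow> bool) set \<Rightarrow> ('a \<Rightarrow> 'a set) \<Rightarrow> 'a measure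
      \<Rightarrow> (real \<Rightarrow> real \<Rightarrow> nat) \<Rightarrow> bool" where
  "pac_learns_with_improvements A H \<Delta> D M \<longleftrightarrow>
     (\<forall>f\<in>H. \<forall>\<epsilon>>0. \<forall>\<delta>>0.
        measure (PiM {..<M \<epsilon> \<delta>} (\<lambda>_. D))
          {s \<in> space (PiM {..<M \<epsilon> \<delta>} (\<lambda>_. D)).
             error_event D \<Delta> (A (labeled_sample f (M \<epsilon> \<delta>) s)) f \<in> sets D \<and>
             population_loss D \<Delta> (A (labeled_sample f (M \<epsilon> \<delta>) s)) f \<le> \<epsilon>}
        \<ge> 1 - \<delta>)"

text \<open>
  The instance space is a measurable space \<open>S\<close>: only \<open>space S\<close> and \<open>sets S\<close> are used, and
  \<open>D\<close> ranges over all probability measures on it.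
\<close>

definition pac_learnable_with_improvements ::
    "'a measure \<Rightarrow> ('a \<Rightarrow> bool) set \<Rightarrow> ('a \<Rightarrow> 'a set) \<Rightarrow> bool" where
  "pac_learnable_with_improvements S H \<Delta> \<longleftrightarrow>
     (\<exists>M A. \<forall>D. prob_space D \<and> sets D = sets S \<longrightarrow> pac_learns_with_improvements A H \<Delta> D M)"

end

theory Submission
  imports Defs
begin

text \<open>
  Not necessary: if every point can improve to a point \<open>0\<close> that all targets label positive, then
  the hypothesis that is positive at \<open>0\<close> only has no loss, however rich the class is elsewhere.

  Not sufficient: the target \<open>odd_except b\<close> is positive on the odd numbers other than
  \<open>2 * b + 1\<close>, and even numbers can move anywhere.  Under the uniform distribution on
  \<open>{..<2 * n}\<close>, a hypothesis of small loss is positive on most odd numbers, but it must be negative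
  at \<open>2 * b + 1\<close>, since otherwise every even number can move there.  A sample that misses
  \<open>2 * b + 1\<close> carries no information about \<open>b\<close>, so the output on a given sample suits only a small
  fraction of the targets; averaging over \<open>b < n\<close> gives a contradiction for large \<open>n\<close>.
\<close>

text \<open>Even for an infinite reaction set, the values of the loss form a nonempty subset of {0,
  1}, so \<open>Max\<close> is a true maximum.\<close>

lemma improvement_loss_eq_1_iff:
  "improvement_loss \<Delta> h f x = 1 \<longleftrightarrow> (\<exists>x'\<in>reaction_set \<Delta> h x. h x' \<noteq> f x')"
proof -
  define A where "A = (\<lambda>x'. of_bool (h x' \<noteq> f x') :: nat) ` reaction_set \<Delta> h x"
  have le: "\<forall>a\<in>A. a \<le> 1" by (auto simp: A_def)
  have "A \<subseteq> {0, 1}" by (auto simp: A_def)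
  then have "finite A" by (rule finite_subset) simp
  moreover have "A \<noteq> {}" by (auto simp: A_def reaction_set_def)
  ultimately have "Max A = 1 \<longleftrightarrow> 1 \<in> A \<and> (\<forall>a\<in>A. a \<le> 1)"
    by (rule Max_eq_iff)
  with le have "Max A = 1 \<longleftrightarrow> 1 \<in> A" by blast
  also have "\<dots> \<longleftrightarrow> (\<exists>x'\<in>reaction_set \<Delta> h x. h x' \<noteq> f x')"
    by (auto simp: A_def image_iff)
  finally show ?thesis unfolding improvement_loss_def A_def .
qed

lemma error_event_eq:
  "error_event D \<Delta> h f = {x \<in> space D. \<exists>x'\<in>reaction_set \<Delta> h x. h x' \<noteq> f x'}"
  unfolding error_event_def improvement_loss_eq_1_iff ..

lemma vc_dim_infinite:
  assumes "\<And>n. \<exists>S\<subseteq>X. finite S \<and> card S = n \<and> shatters H S"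
  shows "vc_dim X H = \<infinity>"
proof (rule ccontr)
  assume "vc_dim X H \<noteq> \<infinity>"
  then obtain n where n: "vc_dim X H = enat n" by auto
  obtain S where "S \<subseteq> X" "finite S" "card S = Suc n" "shatters H S"
    using assms by blast
  then have "enat (card S) \<le> vc_dim X H"
    unfolding vc_dim_def by (intro SUP_upper) auto
  with n \<open>card S = Suc n\<close> show False by simp
qed

lemma vc_dim_le:
  assumes "\<And>S. S \<subseteq> X \<Longrightarrow> finite S \<Longrightarrow> shatters H S \<Longrightarrow> card S \<le> d"
  shows "vc_dim X H \<le> enat d"
  unfolding vc_dim_def using assms by (auto intro!: SUP_least)

lemma vc_dim_functions_fixed_at_0:
  "vc_dim UNIV {f :: nat \<Rightarrow> bool. f 0} = \<infinity>"
proof (rule vc_dim_infinite)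
  fix n :: nat
  let ?restrict = "\<lambda>f. {x \<in> {1..n}. f x}"
  have "?restrict ` {f. f 0} = Pow {1..n}"
  proof
    show "Pow {1..n} \<subseteq> ?restrict ` {f. f 0}"
    proof
      fix T assume "T \<in> Pow {1..n}"
      then have "T = ?restrict (\<lambda>x. x = 0 \<or> x \<in> T)" by auto
      then show "T \<in> ?restrict ` {f. f 0}" by (rule image_eqI[where x = "\<lambda>x. x = 0 \<or> x \<in> T"]) simp
    qed
  qed auto
  then have "shatters {f. f 0} {1..n}"
    unfolding shatters_def .
  then show "\<exists>S\<subseteq>UNIV. finite S \<and> card S = n \<and> shatters {f :: nat \<Rightarrow> bool. f 0} S"
    by (intro exI[of _ "{1..n}"]) simp
qed

text \<open>A constant output with sample size 0 suffices: the error event is empty for every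
  target.\<close>

lemma pac_learnable_functions_fixed_at_0:
  "pac_learnable_with_improvements S {f :: nat \<Rightarrow> bool. f 0} (\<lambda>_. {0})"
  unfolding pac_learnable_with_improvements_def
proof (intro exI allI impI)
  fix D :: "nat measure"
  assume "prob_space D \<and> sets D = sets S"
  then interpret prob_space "PiM {..<0::nat} (\<lambda>_. D)"
    by (intro prob_space_PiM) simp
  have "error_event D (\<lambda>_. {0}) (\<lambda>x. x = 0) f = {}" if "f 0" for f
    using that by (auto simp: error_event_eq reaction_set_def)
  then show "pac_learns_with_improvements (\<lambda>_ x. x = 0) {f. f 0} (\<lambda>_. {0}) D (\<lambda>_ _. 0)"
    by (auto simp: pac_learns_with_improvements_def population_loss_def prob_space
        simp del: lessThan_0)
qed

text \<open>Double counting: the expected number of events \<open>G i\<close> that occur is the sum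
  of their probabilities, and the number that occur is at most \<open>c\<close> at every
  point.\<close>

lemma (in prob_space) card_le_of_prob_ge:
  assumes "finite I" and G: "\<And>i. i \<in> I \<Longrightarrow> G i \<in> events"
    and p: "\<And>i. i \<in> I \<Longrightarrow> p \<le> prob (G i)"
    and c: "\<And>x. x \<in> space M \<Longrightarrow> real (card {i \<in> I. x \<in> G i}) \<le> c"
  shows "real (card I) * p \<le> c"
proof -
  have int: "integrable M (\<lambda>x. indicator (G i) x :: real)" if "i \<in> I" for i
    using G[OF that] by (simp add: less_top[symmetric])
  have "real (card I) * p \<le> (\<Sum>i\<in>I. prob (G i))"
    using sum_bounded_below[of I p "\<lambda>i. prob (G i)"] p by simp
  also have "\<dots> = (\<Sum>i\<in>I. expectation (indicator (G i)))"
    using G by (intro sum.cong) (auto simp: Int_absorb1 sets.sets_into_space)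
  also have "\<dots> = expectation (\<lambda>x. \<Sum>i\<in>I. indicator (G i) x)"
    using int by simp
  also have "\<dots> \<le> expectation (\<lambda>_. c)"
  proof (rule integral_mono)
    show "(\<Sum>i\<in>I. indicator (G i) x) \<le> c" if "x \<in> space M" for x
      using c[OF that] \<open>finite I\<close> by (simp add: indicator_def sum_of_bool_eq Int_def)
  qed (use int in auto)
  also have "\<dots> = c" by (simp add: prob_space)
  finally show ?thesis .
qed

definition odd_except :: "nat \<Rightarrow> nat \<Rightarrow> bool" where
  "odd_except b x \<longleftrightarrow> odd x \<and> x \<noteq> 2 * b + 1"

text \<open>Odd points stay put, so a false negative at an odd point is an error that no move
  repairs.\<close>

definition even_moves :: "nat \<Rightarrow> nat set" where
  "even_moves x = (if even x then UNIV else {})"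

text \<open>The full trace forces all points of \<open>S\<close> to be odd, and the empty trace then
  leaves only the exception of a single target.\<close>

lemma vc_dim_odd_except: "vc_dim UNIV (range odd_except) \<le> enat 1"
proof (rule vc_dim_le)
  fix S :: "nat set"
  assume "shatters (range odd_except) S"
  then have "S \<in> (\<lambda>f. {x \<in> S. f x}) ` range odd_except"
    and "{} \<in> (\<lambda>f. {x \<in> S. f x}) ` range odd_except"
    unfolding shatters_def by auto
  then obtain a b where "{x \<in> S. odd_except a x} = S" "{x \<in> S. odd_except b x} = {}"
    by auto
  then have "S \<subseteq> {2 * b + 1}"
    by (auto simp: odd_except_def)
  then show "card S \<le> 1"
    using card_mono[of "{2 * b + 1}" S] by simp
qed

text \<open>The right-hand side is free of \<open>b\<close>, so all targets whose exception is
  missed share one output hypothesis.\<close>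

lemma labeled_sample_odd_except:
  assumes "\<forall>i<m. s i \<noteq> 2 * b + 1"
  shows "labeled_sample (odd_except b) m s = labeled_sample odd m s"
  using assms by (auto simp: labeled_sample_def odd_except_def)

text \<open>Either \<open>x\<close> stays and is itself a false positive, or the false positive
  \<open>2 * b + 1\<close> is among its reactions, and the loss takes the worst one.\<close>

lemma even_in_error_event:
  assumes "h (2 * b + 1)" "even x"
  shows "x \<in> error_event (measure_pmf q) even_moves h (odd_except b)"
proof -
  have "\<exists>x'\<in>reaction_set even_moves h x. h x' \<noteq> odd_except b x'"
  proof (cases "h x")
    case True
    with assms show ?thesis by (auto simp: reaction_set_def odd_except_def)
  next
    case False
    with assms have "2 * b + 1 \<in> reaction_set even_moves h x"
      by (auto simp: reaction_set_def even_moves_def)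
    with assms show ?thesis by (intro bexI[of _ "2 * b + 1"]) (auto simp: odd_except_def)
  qed
  then show ?thesis by (simp add: error_event_eq)
qed

lemma odd_in_error_event:
  assumes "\<not> h x" "odd x" "x \<noteq> 2 * b + 1"
  shows "x \<in> error_event (measure_pmf q) even_moves h (odd_except b)"
  using assms by (auto simp: error_event_eq reaction_set_def even_moves_def odd_except_def)

lemma small_loss_imp:
  fixes n b :: nat
  defines "D \<equiv> measure_pmf (pmf_of_set {..<2 * n})"
  assumes "n > 0" and loss: "population_loss D even_moves h (odd_except b) \<le> 1 / 8"
  shows "\<not> h (2 * b + 1)" and "real (card {i. i < n \<and> \<not> h (2 * i + 1)}) \<le> n / 4 + 1"
proof -
  let ?E = "error_event D even_moves h (odd_except b)"
  have "measure D ?E = real (card ({..<2 * n} \<inter> ?E)) / real (2 * n)"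
    using \<open>n > 0\<close> unfolding D_def by (subst measure_pmf_of_set) (auto simp: lessThan_empty_iff)
  \<comment> \<open>A fraction 1/8 of \<open>2 * n\<close> points is n/4, fewer than the n even
    ones.\<close>
  with loss \<open>n > 0\<close> have E: "real (card ({..<2 * n} \<inter> ?E)) \<le> n / 4"
    by (simp add: population_loss_def field_simps)
  have card_le: "real (card B) \<le> n / 4"
    if "inj_on g B" "g ` B \<subseteq> {..<2 * n} \<inter> ?E" for g and B :: "nat set"
    using E card_inj_on_le[OF that] by simp
  show "\<not> h (2 * b + 1)"
  proof
    assume "h (2 * b + 1)"
    then have "(*) 2 ` {..<n} \<subseteq> {..<2 * n} \<inter> ?E"
      unfolding D_def by (auto intro: even_in_error_event)
    then have "real (card {..<n}) \<le> n / 4"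
      by (intro card_le) (auto simp: inj_on_def)
    with \<open>n > 0\<close> show False by simp
  qed
  let ?N = "{i. i < n \<and> \<not> h (2 * i + 1)}"
  \<comment> \<open>At \<open>2 * b + 1\<close> the negative label is correct; leaving out
    \<open>b\<close> costs the summand 1 in the bound.\<close>
  have "(\<lambda>i. 2 * i + 1) ` (?N - {b}) \<subseteq> {..<2 * n} \<inter> ?E"
    unfolding D_def by (auto intro!: odd_in_error_event)
  then have "real (card (?N - {b})) \<le> n / 4"
    by (intro card_le) (auto simp: inj_on_def)
  moreover have "card ?N \<le> card (?N - {b}) + 1"
    using card_Suc_Diff1[of ?N b] by (cases "b \<in> ?N") auto
  ultimately show "real (card ?N) \<le> n / 4 + 1" by linarith
qed

lemma not_pac_learnable_odd_except:
  "\<not> pac_learnable_with_improvements (count_space UNIV) (range odd_except) even_moves"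
proof
  assume "pac_learnable_with_improvements (count_space UNIV) (range odd_except) even_moves"
  then obtain M A where learns: "\<And>D. prob_space D \<Longrightarrow> sets D = sets (count_space UNIV) \<Longrightarrow>
      pac_learns_with_improvements A (range odd_except) even_moves D M"
    unfolding pac_learnable_with_improvements_def by blast
  define m where "m = M (1/8) (1/2)"
  \<comment> \<open>The averaging will give n/2 \<le> n/4 + 1 + m, that is, n \<le> 4m + 4; this is
    the least n that violates it.\<close>
  define n where "n = 4 * m + 5"
  define D where "D = measure_pmf (pmf_of_set {..<2 * n})"
  define P where "P = PiM {..<m} (\<lambda>_. D)"
  define G where "G b = {s \<in> space P.
      error_event D even_moves (A (labeled_sample (odd_except b) m s)) (odd_except b) \<in> sets D \<and>
      population_loss D even_moves (A (labeled_sample (odd_except b) m s)) (odd_except b) \<le> 1 / 8}"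
    for b
  have D: "prob_space D" "sets D = sets (count_space UNIV)"
    unfolding D_def by (auto intro: prob_space_measure_pmf)
  then interpret P: prob_space P
    unfolding P_def by (intro prob_space_PiM)
  have G: "1 / 2 \<le> P.prob (G b)" for b
  proof -
    have "1 - 1 / 2 \<le> P.prob (G b)"
      using learns[OF D, unfolded pac_learns_with_improvements_def, rule_format,
          of "odd_except b" "1/8" "1/2"]
      unfolding G_def P_def m_def by simp
    then show ?thesis by simp
  qed
  \<comment> \<open>A nonmeasurable set has \<open>measure\<close> 0.\<close>
  have "G b \<in> P.events" for b
    using G[of b] measure_notin_sets[of "G b" P] by fastforce
  moreover have "real (card {b \<in> {..<n}. s \<in> G b}) \<le> n / 4 + 1 + m" for s
  proof -
    let ?S = "{b \<in> {..<n}. s \<in> G b}"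
    \<comment> \<open>A sampled \<open>2 * b\<close> also counts as seeing \<open>b\<close>; this
      keeps the bound \<open>m\<close> on the number of seen indices.\<close>
    let ?seen = "(\<lambda>i. s i div 2) ` {..<m}"
    define h where "h = A (labeled_sample odd m s)"
    let ?N = "{i. i < n \<and> \<not> h (2 * i + 1)}"
    \<comment> \<open>\<open>h\<close> is the common output, so a single set \<open>?N\<close>
      contains all unseen good \<open>b\<close>, and any one of them bounds its size.\<close>
    have unseen: "b \<in> ?N \<and> real (card ?N) \<le> n / 4 + 1" if "b \<in> ?S - ?seen" for b
    proof -
      have "\<forall>i<m. s i \<noteq> 2 * b + 1"
        using that by (force simp: image_iff)
      then have "population_loss D even_moves h (odd_except b) \<le> 1 / 8"
        using that labeled_sample_odd_except[of m s b] by (simp add: G_def h_def)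
      then show ?thesis
        using small_loss_imp[of n h b] that by (simp add: D_def n_def)
    qed
    have "real (card (?S - ?seen)) \<le> n / 4 + 1"
    proof (cases "?S - ?seen = {}")
      case False
      then have "real (card ?N) \<le> n / 4 + 1" using unseen by blast
      moreover have "card (?S - ?seen) \<le> card ?N"
        using unseen by (intro card_mono) auto
      ultimately show ?thesis by linarith
    qed (simp only: card.empty)
    moreover have "card ?seen \<le> m"
      using card_image_le[of "{..<m}" "\<lambda>i. s i div 2"] by simp
    moreover have "card ?S \<le> card ((?S - ?seen) \<union> ?seen)"
      by (intro card_mono) auto
    then have "card ?S \<le> card (?S - ?seen) + card ?seen"
      using card_Un_le[of "?S - ?seen" ?seen] by linarith
    ultimately show ?thesis by linarith
  qed
  ultimately have "real (card {..<n}) * (1 / 2) \<le> n / 4 + 1 + m"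
    using G by (intro P.card_le_of_prob_ge[of _ G]) auto
  then show False by (simp add: n_def)
qed

theorem theorem3p1:
  shows "(\<exists>(X :: nat set) (H :: (nat \<Rightarrow> bool) set) (\<Delta> :: nat \<Rightarrow> nat set).
            H \<subseteq> X \<rightarrow>\<^sub>E UNIV \<and> \<Delta> \<in> X \<rightarrow> Pow X \<and>
            vc_dim X H = \<infinity> \<and>
            pac_learnable_with_improvements (count_space X) H \<Delta>) \<and>
         (\<exists>(X :: nat set) (H :: (nat \<Rightarrow> bool) set) (\<Delta> :: nat \<Rightarrow> nat set).
            H \<subseteq> X \<rightarrow>\<^sub>E UNIV \<and> \<Delta> \<in> X \<rightarrow> Pow X \<and>
            vc_dim X H < \<infinity> \<and>
            \<not> pac_learnable_with_improvements (count_space X) H \<Delta>)"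
proof (intro conjI exI)
  show "vc_dim UNIV {f :: nat \<Rightarrow> bool. f 0} = \<infinity>"
    by (rule vc_dim_functions_fixed_at_0)
  show "pac_learnable_with_improvements (count_space UNIV) {f :: nat \<Rightarrow> bool. f 0} (\<lambda>_. {0})"
    by (rule pac_learnable_functions_fixed_at_0)
  show "vc_dim UNIV (range odd_except) < \<infinity>"
    using vc_dim_odd_except by (rule order.strict_trans1) simp
  show "\<not> pac_learnable_with_improvements (count_space UNIV) (range odd_except) even_moves"
    by (rule not_pac_learnable_odd_except)
qed auto

end
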